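(* Let $\rho>0$, $\alpha\in(0,1)$, $T>0$, $A\in\mathbb{R}^{n\times n}$, $B\in\mathbb{R}^{n\times m}$, $C\in\mathbb{R}^{p\times n}$ and $D\in\mathbb{R}^{p\times m}$, and let $t_f\in(0,T]$. The tempered fractional linear system $$ {}^T D_0^{\alpha,\rho}y(t)=Ay(t)+Bu(t),\quad t\in[0,T],\qquad y(0)=y_0\in\mathbb{R}^n, $$ with output $$ z(t)=Cy(t)+Du(t)\in\mathbb{R}^p, $$ is observable on $[0,t_f]$ if, and only if, the observability Gramian matrix $$ W_o[0,t_f]:=\int_0^{t_f}e^{-\rho t}E_\alpha(At^\alpha)^{*}\,C^{*}C\,e^{-\rho t}E_\alpha(At^\alpha)\,dt $$ is non-singular.
   Context: For $\alpha\in(0,1)$ and $\rho>0$, the Caputo tempered fractional derivative of a function $v$ (a $C^1$ function; applied componentwise to vector-valued functions) is $$ {}^T D_0^{\alpha,\rho}v(t)=\frac{1}{\Gamma(1-\alpha)}\int_0^t e^{-\rho(t-s)}(t-s)^{-\alpha}\big(\rho v(s)+v'(s)\big)\,ds, $$ where $\Gamma$ is the Euler gamma function. The Mittag-Leffler functions of a square matrix $M$ are $E_\alpha(M)=\sum_{l=0}^{\infty}\frac{M^l}{\Gamma(\alpha l+1)}$ and $E_{\alpha,\alpha'}(M)=\sum_{l=0}^{\infty}\frac{M^l}{\Gamma(\alpha l+\alpha')}$, for $\alpha,\alpha'>0$. The symbol $^*$ denotes the matrix transpose. The solution of the system associated with an input $u:[0,T]\to\mathbb{R}^m$ and an initial state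 $y_0$ is given by $$ y(t)=e^{-\rho t}E_\alpha(At^\alpha)y_0+\int_0^t e^{-\rho(t-\tau)}(t-\tau)^{\alpha-1}E_{\alpha,\alpha}\big(A(t-\tau)^\alpha\big)Bu(\tau)\,d\tau. $$ Definition (observability): the system with output is (state) observable on $[0,t_f]$ if any initial condition $y(0)=y_0\in\mathbb{R}^n$ is uniquely determined by the associated system input $u(t)$ and output $z(t)$, $t\in[0,t_f]$. *)

theory Defs
  imports "HOL-Analysis.Analysis"
begin

(* On vec types the power operation is componentwise, so the matrix powers M^l have to be
   defined separately. *)
primrec matrix_power :: "real^'n^'n \<Rightarrow> nat \<Rightarrow> real^'n^'n" where
  "matrix_power M 0 = mat 1"
| "matrix_power M (Suc l) = M ** matrix_power M l"

definition mittag_leffler :: "real \<Rightarrow> real^'n^'n \<Rightarrow> real^'n^'n" where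
  "mittag_leffler \<alpha> M = (\<Sum>l. (1 / Gamma (\<alpha> * real l + 1)) *\<^sub>R matrix_power M l)"

(* v'(s) is taken within {0..t}, so the value depends only on v restricted to [0,t].
   At s = t, HOL evaluates 0 powr (-\<alpha>) to 0, which does not affect the integral. *)
definition caputo_tempered ::
  "real \<Rightarrow> real \<Rightarrow> (real \<Rightarrow> real^'n) \<Rightarrow> real \<Rightarrow> real^'n" where
  "caputo_tempered \<alpha> \<rho> v t =
     (1 / Gamma (1 - \<alpha>)) *\<^sub>R
       integral {0..t} (\<lambda>s. (exp (- \<rho> * (t - s)) * (t - s) powr (- \<alpha>)) *\<^sub>R
         (\<rho> *\<^sub>R v s + vector_derivative v (at s within {0..t})))"

(* The solution class: continuous on [0,T], continuously differentiable on (0,T], with absolutely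
   integrable derivative (the value v' 0 is irrelevant).  Requiring C^1 up to t = 0 would be too
   strong: solutions behave like y0 + t^\<alpha> A y0 / Gamma (\<alpha> + 1) near 0, so already
   E_\<alpha>(A t^\<alpha>) y0 has an integrable singularity of its derivative at 0 unless A y0 = 0.
   On this class the integral in caputo_tempered converges absolutely for every t in (0,T]. *)
definition solution_class :: "real \<Rightarrow> (real \<Rightarrow> real^'n) \<Rightarrow> bool" where
  "solution_class T v \<longleftrightarrow>
     continuous_on {0..T} v \<and>
     (\<exists>v'. (\<forall>t\<in>{0<..T}. (v has_vector_derivative v' t) (at t within {0..T})) \<and>
           continuous_on {0<..T} v' \<and>
           v' absolutely_integrable_on {0..T})"

(* The equation is imposed on (0,T].  At t = 0 the Caputo integral is over a degenerate interval
   and equals 0, so the equation there would amount to the spurious constraint A y0 + B u(0) = 0;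
   the initial condition takes its place. *)
definition is_solution ::
  "real \<Rightarrow> real \<Rightarrow> real \<Rightarrow> real^'n^'n \<Rightarrow> real^'m^'n \<Rightarrow>
   (real \<Rightarrow> real^'m) \<Rightarrow> real^'n \<Rightarrow> (real \<Rightarrow> real^'n) \<Rightarrow> bool" where
  "is_solution \<alpha> \<rho> T A B u y0 y \<longleftrightarrow>
     solution_class T y \<and> y 0 = y0 \<and>
     (\<forall>t\<in>{0<..T}. caputo_tempered \<alpha> \<rho> y t = A *v y t + B *v u t)"

definition system_output ::
  "real^'n^'p \<Rightarrow> real^'m^'p \<Rightarrow> (real \<Rightarrow> real^'m) \<Rightarrow> (real \<Rightarrow> real^'n) \<Rightarrow> real \<Rightarrow> real^'p" where
  "system_output C D u y t = C *v y t + D *v u t"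

(* Input and output are known on [0,tf] only; beyond tf the two inputs may differ. *)
definition observable ::
  "real \<Rightarrow> real \<Rightarrow> real \<Rightarrow> real^'n^'n \<Rightarrow> real^'m^'n \<Rightarrow> real^'n^'p \<Rightarrow> real^'m^'p \<Rightarrow> real \<Rightarrow> bool" where
  "observable \<alpha> \<rho> T A B C D tf \<longleftrightarrow>
     (\<forall>u\<^sub>1 u\<^sub>2 y\<^sub>1 y\<^sub>2 a\<^sub>1 a\<^sub>2.
        is_solution \<alpha> \<rho> T A B u\<^sub>1 a\<^sub>1 y\<^sub>1 \<and> is_solution \<alpha> \<rho> T A B u\<^sub>2 a\<^sub>2 y\<^sub>2 \<and>
        (\<forall>t\<in>{0..tf}. u\<^sub>1 t = u\<^sub>2 t) \<and>
        (\<forall>t\<in>{0..tf}. system_output C D u\<^sub>1 y\<^sub>1 t = system_output C D u\<^sub>2 y\<^sub>2 t)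
        \<longrightarrow> a\<^sub>1 = a\<^sub>2)"

definition observability_gramian ::
  "real \<Rightarrow> real \<Rightarrow> real^'n^'n \<Rightarrow> real^'n^'p \<Rightarrow> real \<Rightarrow> real^'n^'n" where
  "observability_gramian \<alpha> \<rho> A C tf =
     integral {0..tf} (\<lambda>t.
       (exp (- \<rho> * t) *\<^sub>R transpose (mittag_leffler \<alpha> ((t powr \<alpha>) *\<^sub>R A))) ** transpose C ** C
       ** (exp (- \<rho> * t) *\<^sub>R mittag_leffler \<alpha> ((t powr \<alpha>) *\<^sub>R A)))"

end

theory Submission
  imports Defs
begin

text \<open>
  Multiplying by \<open>exp (\<rho> t)\<close> removes the tempering: for \<open>x t = exp (\<rho> t) y t\<close> the equation without
  input reads \<open>I\<^sup>1\<^sup>-\<^sup>\<alpha> x' = A x\<close>, where \<open>I\<^sup>\<beta> f t = (1 / \<Gamma> \<beta>) \<integral>\<^sub>0\<^sup>t (t - s)\<^sup>\<beta>\<^sup>-\<^sup>1 f s ds\<close> is the fractional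
  integral.  Everything rests on the fact that the solutions of this equation are exactly the orbits
  \<open>t \<mapsto> E\<^sub>\<alpha>(A t\<^sup>\<alpha>) a\<close>.

  The orbits are solutions (\<open>mittag_leffler_is_solution\<close>): each component of an orbit is an entire
  power series in \<open>t\<^sup>\<alpha>\<close>, which is differentiated termwise, and a Beta integral shows that
  \<open>I\<^sup>1\<^sup>-\<^sup>\<alpha>\<close> of the derivative only shifts the coefficients by one place; for the
  coefficients \<open>A\<^sup>l a\<close> the shift is multiplication by \<open>A\<close>.

  There are no others (\<open>free_solution_unique\<close>): the operators \<open>I\<^sup>\<alpha>\<close> and \<open>I\<^sup>1\<^sup>-\<^sup>\<alpha>\<close> compose to ordinary
  integration by Fubini (\<open>abel_inversion\<close>), so a solution that starts at 0 satisfies \<open>x = I\<^sup>\<alpha> (A x)\<close>.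
  Iterating this identity bounds \<open>x\<close> by the terms of a convergent Mittag-Leffler series, whence
  \<open>x = 0\<close> (\<open>volterra_unique\<close>).

  By linearity, two initial states with the same input and output on \<open>[0, tf]\<close> differ by a state
  \<open>a\<close> whose free output \<open>C exp (- \<rho> t) E\<^sub>\<alpha>(A t\<^sup>\<alpha>) a\<close> vanishes there, and every such state
  arises in this way.  Finally \<open>a \<bullet> W a\<close> is the integral of the squared norm of the free output, so these
  states form the kernel of the Gramian \<open>W\<close> (\<open>gramian_kernel\<close>).
\<close>

section \<open>Convergence of Mittag-Leffler series\<close>

text \<open>
  Euler's integral over \<open>[R, \<infinity>)\<close> alone is at least this large.  Since \<open>R\<close> is free, Gamma outgrows
  every geometric sequence along arithmetic progressions; this is how Mittag-Leffler series are
  shown to converge.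
\<close>

lemma Gamma_ge_powr_mult_exp:
  fixes x R :: real
  assumes "1 \<le> x" and "0 < R"
  shows "R powr (x - 1) * exp (- R) \<le> Gamma x"
proof -
  have exp_tail: "((\<lambda>t. R powr (x - 1) * exp (- 1 * t)) has_integral R powr (x - 1) * (exp (- 1 * R) / 1)) {R..}"
    by (intro has_integral_mult_right has_integral_exp_minus_to_infinity) simp
  have tail: "((\<lambda>t. if t \<in> {R..} then R powr (x - 1) * exp (- t) else 0) has_integral R powr (x - 1) * exp (- R)) {0..}"
    using exp_tail assms by (subst has_integral_restrict) auto
  have pos: "x > 0" using assms by simp
  show ?thesis
  proof (rule has_integral_le[OF tail Gamma_integral_real[OF pos]])
    fix t :: real assume "t \<in> {0..}"
    then show "(if t \<in> {R..} then R powr (x - 1) * exp (- t) else 0) \<le> t powr (x - 1) / exp t"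
      using assms by (auto simp: exp_minus field_simps intro!: powr_mono2)
  qed
qed

text \<open>
  Convergence for every \<open>z\<close>: the denominators are at least \<open>q\<^sup>l exp (- R)\<close> for any prescribed \<open>q\<close>, where
  \<open>R\<^sup>\<alpha> = q\<close>.
\<close>

lemma summable_mittag_leffler_coeffs:
  fixes c :: "nat \<Rightarrow> real"
  assumes "0 < \<alpha>" and c: "\<And>l. \<bar>c l\<bar> \<le> M * K ^ l" and "0 \<le> K"
  shows "summable (\<lambda>l. c l / Gamma (\<alpha> * real l + 1) * z ^ l)"
proof -
  \<comment> \<open>chosen so that the ratio of the dominating geometric series is at most one half\<close>
  define q where "q = 2 * (K * \<bar>z\<bar> + 1)"
  have q: "q > 0" using assms by (auto simp: q_def intro!: add_nonneg_pos)
  define R where "R = q powr (1 / \<alpha>)"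
  have R: "R > 0" "R powr \<alpha> = q" using q assms by (auto simp: R_def powr_powr)
  have M: "M \<ge> 0" using c[of 0] by simp
  have ratio: "K * \<bar>z\<bar> / q \<le> 1 / 2" using q by (auto simp: q_def field_simps)
  show ?thesis
  proof (rule summable_comparison_test')
    show "summable (\<lambda>l. (M * exp R) * (1 / 2 :: real) ^ l)" by (intro summable_mult summable_geometric) simp
    fix l :: nat
    have "R powr (\<alpha> * real l) * exp (- R) \<le> Gamma (\<alpha> * real l + 1)"
      using Gamma_ge_powr_mult_exp[of "\<alpha> * real l + 1" R] R assms by simp
    moreover have "R powr (\<alpha> * real l) = q ^ l"
      using R q by (simp add: powr_powr[symmetric] powr_realpow)
    ultimately have G: "q ^ l * exp (- R) \<le> Gamma (\<alpha> * real l + 1)" by simp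
    have "norm (c l / Gamma (\<alpha> * real l + 1) * z ^ l) = \<bar>c l\<bar> / Gamma (\<alpha> * real l + 1) * \<bar>z\<bar> ^ l"
      using assms by (simp add: abs_mult power_abs add_nonneg_pos)
    also have "\<dots> \<le> (M * K ^ l) / (q ^ l * exp (- R)) * \<bar>z\<bar> ^ l"
      using c[of l] M assms q by (intro mult_right_mono frac_le G) auto
    also have "\<dots> = M * exp R * (K * \<bar>z\<bar> / q) ^ l"
      by (simp add: exp_minus field_simps power_mult_distrib power_divide)
    also have "\<dots> \<le> M * exp R * (1 / 2) ^ l"
      using M ratio q assms by (intro mult_left_mono power_mono) auto
    finally show "norm (c l / Gamma (\<alpha> * real l + 1) * z ^ l) \<le> M * exp R * (1 / 2) ^ l" .
  qed
qed

section \<open>Weakly singular kernels\<close>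

text \<open>
  Euler's Beta integral, transported to \<open>[p, q]\<close>: with \<open>p = 0\<close> it is the fractional integral of a
  power of time, with a variable left end point it is the inner integral in \<open>abel_inversion\<close>.
\<close>

lemma has_integral_Beta_interval:
  fixes a b p q :: real
  assumes "0 < a" and "0 < b" and "p < q"
  shows "((\<lambda>s. (s - p) powr (a - 1) * (q - s) powr (b - 1)) has_integral
           (q - p) powr (a + b - 1) * Beta a b) {p..q}"
proof -
  let ?L = "q - p"
  have L: "?L > 0" using assms by simp
  have "((\<lambda>x. ((1 / ?L) *\<^sub>R x + - p / ?L) powr (a - 1) * (1 - ((1 / ?L) *\<^sub>R x + - p / ?L)) powr (b - 1))
      has_integral Beta a b /\<^sub>R (1 / ?L) ^ DIM(real)) (cbox ((0 - - p / ?L) /\<^sub>R (1 / ?L)) ((1 - - p / ?L) /\<^sub>R (1 / ?L)))"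
    using has_integral_affinity'[of _ "Beta a b" 0 1 "1 / ?L" "- p / ?L"] has_integral_Beta_real[OF assms(1,2)] L
    by simp
  also have "cbox ((0 - - p / ?L) /\<^sub>R (1 / ?L)) ((1 - - p / ?L) /\<^sub>R (1 / ?L)) = {p..q}"
    using L by (simp add: field_simps)
  finally have "((\<lambda>x. ?L powr (a + b - 2) * (((1 / ?L) *\<^sub>R x + - p / ?L) powr (a - 1) * (1 - ((1 / ?L) *\<^sub>R x + - p / ?L)) powr (b - 1)))
      has_integral ?L powr (a + b - 2) * (Beta a b /\<^sub>R (1 / ?L) ^ DIM(real))) {p..q}"
    by (rule has_integral_mult_right)
  moreover have "?L powr (a + b - 2) * (Beta a b /\<^sub>R (1 / ?L) ^ DIM(real)) = ?L powr (a + b - 1) * Beta a b"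
  proof -
    have "?L powr (a + b - 1) = ?L powr (a + b - 2) * ?L" using L
      using powr_add[of ?L "a + b - 2" 1] by (simp add: add.commute)
    then show ?thesis using L by simp
  qed
  ultimately show ?thesis
  proof (rule has_integral_eq[rotated, OF back_subst[of "\<lambda>i. (_ has_integral i) _"]])
    fix s assume s: "s \<in> {p..q}"
    have 1: "(1 / ?L) *\<^sub>R s + - p / ?L = (s - p) / ?L" by (simp add: diff_divide_distrib)
    have "1 - (s - p) / ?L = (?L - (s - p)) / ?L" using L unfolding diff_divide_distrib[of ?L] by simp
    then have 2: "1 - (s - p) / ?L = (q - s) / ?L" by simp
    have 3: "?L powr (a + b - 2) = ?L powr (a - 1) * ?L powr (b - 1)"
      by (simp add: powr_add[symmetric] algebra_simps)
    show "?L powr (a + b - 2) * (((1 / ?L) *\<^sub>R s + - p / ?L) powr (a - 1) *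
        (1 - ((1 / ?L) *\<^sub>R s + - p / ?L)) powr (b - 1)) = (s - p) powr (a - 1) * (q - s) powr (b - 1)"
      unfolding 1 2 3 using s L by (simp add: powr_divide)
  qed
qed

lemma has_integral_powr_kernel:
  fixes b t :: real
  assumes "0 < b" and "0 \<le> t"
  shows "((\<lambda>s. (t - s) powr (b - 1)) has_integral t powr b / b) {0..t}"
proof (cases "t = 0")
  case False
  have "b \<notin> \<int>\<^sub>\<le>\<^sub>0" using assms nonpos_Ints_nonpos[of b] by force
  then have Beta_1: "Beta 1 b = 1 / b"
    using assms Gamma_plus1[of b] Gamma_eq_zero_iff[of b] by (simp add: Beta_def add.commute[of 1])
  have "((\<lambda>s. (s - 0) powr (1 - 1) * (t - s) powr (b - 1)) has_integral (t - 0) powr (1 + b - 1) * Beta 1 b) {0..t}"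
    using False assms by (intro has_integral_Beta_interval) auto
  then have "((\<lambda>s. (s - 0) powr (1 - 1) * (t - s) powr (b - 1)) has_integral t powr b / b) {0..t}"
    using Beta_1 by simp
  then show ?thesis
    by (rule has_integral_spike_finite[of "{0}", rotated 2]) auto
qed (use assms in auto)

text \<open>
  The singularity of \<open>f\<close> at 0 and that of the kernel at \<open>t\<close> do not meet: on the left half of
  \<open>[0, t]\<close> the kernel is bounded, on the right half \<open>f\<close> is.
\<close>

lemma abel_absolutely_integrable:
  fixes f :: "real \<Rightarrow> 'a::euclidean_space"
  assumes "0 < b" and f: "f absolutely_integrable_on {0..T}" and cont: "continuous_on {0<..T} f"
    and t: "0 < t" "t \<le> T"
  shows "(\<lambda>s. (t - s) powr (b - 1) *\<^sub>R f s) absolutely_integrable_on {0..t}"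
proof -
  have ft: "f absolutely_integrable_on {0..t}"
    using f t by (intro absolutely_integrable_on_subinterval[OF f]) auto
  have "compact (f ` {t/2..t})"
    using t by (intro compact_continuous_image continuous_on_subset[OF cont]) auto
  then have "bounded (f ` {t/2..t})" by (rule compact_imp_bounded)
  then obtain M where M: "\<And>s. s \<in> {t/2..t} \<Longrightarrow> norm (f s) \<le> M"
    unfolding bounded_iff by (meson imageI)
  \<comment> \<open>the kernel is monotone, increasing or decreasing according to the sign of \<open>b - 1\<close>\<close>
  define C where "C = max (t powr (b - 1)) ((t/2) powr (b - 1))"
  have kernel: "(t - s) powr (b - 1) \<le> C" if s: "s \<in> {0..t/2}" for s
  proof (cases "b \<ge> 1")
    case True
    then have "(t - s) powr (b - 1) \<le> t powr (b - 1)" using s t by (intro powr_mono2) auto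
    then show ?thesis by (simp add: C_def)
  next
    case False
    then have "(t - s) powr (b - 1) \<le> (t/2) powr (b - 1)" using s t by (intro powr_mono2') auto
    then show ?thesis by (simp add: C_def)
  qed
  show ?thesis
  proof (rule measurable_bounded_by_integrable_imp_absolutely_integrable)
    show "(\<lambda>s. (t - s) powr (b - 1) *\<^sub>R f s) \<in> borel_measurable (lebesgue_on {0..t})"
      using absolutely_integrable_imp_borel_measurable[OF ft]
      by (intro borel_measurable_scaleR) (auto intro!: measurable_completion measurable_restrict_space1)
    show "{0..t} \<in> sets lebesgue" by simp
    show "(\<lambda>s. C * norm (f s) + M * (t - s) powr (b - 1)) integrable_on {0..t}"
      using ft has_integral_powr_kernel[OF \<open>0 < b\<close>, of t] t
      by (intro integrable_add integrable_on_mult_right) (auto simp: absolutely_integrable_on_def)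
    fix s assume s: "s \<in> {0..t}"
    have "0 \<le> M" using order_trans[OF norm_ge_zero M[of t]] t by simp
    have "0 \<le> C" by (simp add: C_def le_max_iff_disj)
    show "norm ((t - s) powr (b - 1) *\<^sub>R f s) \<le> C * norm (f s) + M * (t - s) powr (b - 1)"
    proof (cases "s \<le> t/2")
      case True
      then have "(t - s) powr (b - 1) * norm (f s) \<le> C * norm (f s)"
        using s by (intro mult_right_mono kernel) auto
      then show ?thesis using \<open>0 \<le> M\<close> by (simp add: add_increasing2)
    next
      case False
      then have "norm (f s) * (t - s) powr (b - 1) \<le> M * (t - s) powr (b - 1)"
        using s by (intro mult_right_mono M) auto
      then show ?thesis using \<open>0 \<le> C\<close> by (simp add: add_increasing mult.commute)
    qed
  qed
qed

text \<open>
  Fubini's theorem is about the Borel-Lebesgue measure on the whole line; this is the passage to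
  gauge integrals over compact intervals, where the end points may be ignored.
\<close>

lemma lborel_integral_eq_integral_interval:
  fixes h q :: "real \<Rightarrow> 'a::euclidean_space"
  assumes h [measurable]: "h \<in> borel_measurable borel" and q: "q absolutely_integrable_on {a..b}"
    and inside: "\<And>r. r \<in> {a<..<b} \<Longrightarrow> h r = q r" and outside: "\<And>r. r \<notin> {a<..<b} \<Longrightarrow> h r = 0"
  shows "integrable lborel h" and "integral\<^sup>L lborel h = integral {a..b} q"
proof -
  have h_eq: "h = (\<lambda>r. indicator {a<..<b} r *\<^sub>R q r)"
    using inside outside by (auto simp: indicator_def)
  have q': "q absolutely_integrable_on {a<..<b}"
    by (rule set_integrable_subset[OF q]) auto
  then have "integrable lebesgue h" unfolding set_integrable_def h_eq .
  then show "integrable lborel h" by (simp add: integrable_completion)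
  have "integral\<^sup>L lborel h = integral\<^sup>L lebesgue h" by (simp add: integral_completion)
  also have "\<dots> = integral {a<..<b} q"
    using set_lebesgue_integral_eq_integral(2)[OF q'] unfolding set_lebesgue_integral_def h_eq .
  also have "\<dots> = integral {a..b} q" by (simp add: integral_open_interval_real)
  finally show "integral\<^sup>L lborel h = integral {a..b} q" .
qed

text \<open>
  Abel's inversion of the fractional integral.  On the triangle \<open>0 < r < s < t\<close> the order of
  integration is exchanged; the integral over \<open>s\<close> is then \<open>Beta (1 - \<alpha>) \<alpha> = \<Gamma> \<alpha> \<Gamma> (1 - \<alpha>)\<close> for every
  \<open>r\<close>, and only the integral of \<open>f\<close> is left.
\<close>

lemma abel_inversion:
  fixes f :: "real \<Rightarrow> 'a::euclidean_space"
  assumes \<alpha>: "0 < \<alpha>" "\<alpha> < 1"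
    and f: "f absolutely_integrable_on {0..T}" and cont: "continuous_on {0<..T} f"
    and t: "0 < t" "t \<le> T"
  shows "((\<lambda>s. (t - s) powr (\<alpha> - 1) *\<^sub>R integral {0..s} (\<lambda>r. (s - r) powr (- \<alpha>) *\<^sub>R f r))
           has_integral (Gamma \<alpha> * Gamma (1 - \<alpha>)) *\<^sub>R integral {0..t} f) {0..t}"
proof -
  \<comment> \<open>\<open>f\<close> is only Lebesgue measurable; cut off to the open interval, on which it is continuous, it is Borel\<close>
  define g where "g = (\<lambda>r. indicator {0<..<t} r *\<^sub>R f r)"
  define k where "k = (\<lambda>s r. if r < s \<and> s < t then (s - r) powr (- \<alpha>) * (t - s) powr (\<alpha> - 1) else 0)"
  define F where "F = (\<lambda>r s. k s r *\<^sub>R g r)"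
  have g [measurable]: "g \<in> borel_measurable borel"
    unfolding g_def using t
    by (intro borel_measurable_continuous_on_indicator continuous_on_subset[OF cont]) auto
  have k [measurable]: "case_prod k \<in> borel_measurable (borel \<Otimes>\<^sub>M borel)"
    unfolding k_def by measurable
  have F [measurable]: "case_prod F \<in> borel_measurable (borel \<Otimes>\<^sub>M borel)"
    unfolding F_def by measurable
  have ft: "f absolutely_integrable_on {0..t}"
    using f t by (intro absolutely_integrable_on_subinterval[OF f]) auto
  have g_int: "integrable lborel g" "integral\<^sup>L lborel g = integral {0..t} f"
    using lborel_integral_eq_integral_interval[OF g ft] by (auto simp: g_def)
  define B where "B = Gamma \<alpha> * Gamma (1 - \<alpha>)"
  have k_int: "integrable lborel (\<lambda>s. k s r)" "(\<integral>s. k s r \<partial>lborel) = B" if r: "r \<in> {0<..<t}" for r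
  proof -
    let ?q = "\<lambda>s. (s - r) powr (- \<alpha>) * (t - s) powr (\<alpha> - 1)"
    have q: "(?q has_integral B) {r..t}"
      using has_integral_Beta_interval[of "1 - \<alpha>" \<alpha> r t] \<alpha> r by (simp add: Beta_def B_def mult.commute)
    then have "?q absolutely_integrable_on {r..t}"
      by (intro nonnegative_absolutely_integrable_1) auto
    note * = lborel_integral_eq_integral_interval[OF _ this, of "\<lambda>s. k s r"]
    show "integrable lborel (\<lambda>s. k s r)" by (rule *) (auto simp: k_def)
    have "(\<integral>s. k s r \<partial>lborel) = integral {r..t} ?q" by (rule *) (auto simp: k_def)
    then show "(\<integral>s. k s r \<partial>lborel) = B" using q by (simp add: integral_unique)
  qed
  have F_int: "integrable lborel (F r)" "(\<integral>s. F r s \<partial>lborel) = B *\<^sub>R g r"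
    "(\<integral>s. norm (F r s) \<partial>lborel) = B * norm (g r)" for r
  proof -
    have "integrable lborel (F r) \<and> (\<integral>s. F r s \<partial>lborel) = B *\<^sub>R g r
      \<and> (\<integral>s. norm (F r s) \<partial>lborel) = B * norm (g r)"
    proof (cases "r \<in> {0<..<t}")
      case True
      have "\<bar>k s r\<bar> = k s r" for s by (simp add: k_def)
      with k_int[OF True] show ?thesis by (simp add: F_def)
    next
      case False
      then have "g r = 0" by (simp add: g_def)
      then show ?thesis by (simp add: F_def)
    qed
    then show "integrable lborel (F r)" "(\<integral>s. F r s \<partial>lborel) = B *\<^sub>R g r"
      "(\<integral>s. norm (F r s) \<partial>lborel) = B * norm (g r)" by auto
  qed
  have F_prod: "integrable (lborel \<Otimes>\<^sub>M lborel) (case_prod F)"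
  proof (rule lborel_pair.Fubini_integrable)
    show "case_prod F \<in> borel_measurable (lborel \<Otimes>\<^sub>M lborel)" by measurable
    show "integrable lborel (\<lambda>r. \<integral>s. norm (case_prod F (r, s)) \<partial>lborel)"
      unfolding case_prod_conv F_int(3) using g_int(1) by simp
    show "AE r in lborel. integrable lborel (\<lambda>s. case_prod F (r, s))"
      unfolding case_prod_conv using F_int(1) by simp
  qed
  define H where "H = (\<lambda>s. \<integral>r. F r s \<partial>lborel)"
  have "integrable lborel H" unfolding H_def by (rule lborel_pair.integrable_snd[OF F_prod])
  then have "(H has_integral integral\<^sup>L lborel H) UNIV" by (rule has_integral_integral_lborel)
  also have "integral\<^sup>L lborel H = B *\<^sub>R integral {0..t} f"
    unfolding H_def using lborel_pair.Fubini_integral[OF F_prod] by (simp add: F_int g_int)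
  finally have H: "(H has_integral B *\<^sub>R integral {0..t} f) UNIV" .
  have H_in: "H s = (t - s) powr (\<alpha> - 1) *\<^sub>R integral {0..s} (\<lambda>r. (s - r) powr (- \<alpha>) *\<^sub>R f r)"
    if s: "s \<in> {0<..<t}" for s
  proof -
    let ?q = "\<lambda>r. (t - s) powr (\<alpha> - 1) *\<^sub>R (s - r) powr (- \<alpha>) *\<^sub>R f r"
    have "(\<lambda>r. (s - r) powr (- \<alpha>) *\<^sub>R f r) absolutely_integrable_on {0..s}"
      using abel_absolutely_integrable[OF _ f cont, of "1 - \<alpha>" s] \<alpha> s t by simp
    then have "?q absolutely_integrable_on {0..s}" by (intro absolutely_integrable_scaleR_left)
    then have "H s = integral {0..s} ?q"
      unfolding H_def
    proof (rule lborel_integral_eq_integral_interval[rotated])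
      show "(\<lambda>r. F r s) \<in> borel_measurable borel" by measurable
      show "F r s = ?q r" if "r \<in> {0<..<s}" for r
        using that s by (simp add: F_def k_def g_def mult.commute)
      show "F r s = 0" if "r \<notin> {0<..<s}" for r
        using that s by (simp add: F_def k_def g_def indicator_def)
    qed
    then show ?thesis by (simp only: integral_cmul)
  qed
  have H_out: "H s = 0" if "s \<notin> {0<..<t}" for s
  proof -
    have "F r s = 0" for r using that by (auto simp: F_def k_def g_def indicator_def)
    then show ?thesis by (simp add: H_def)
  qed
  have "((\<lambda>s. if s \<in> {0..t} then (t - s) powr (\<alpha> - 1) *\<^sub>R
      integral {0..s} (\<lambda>r. (s - r) powr (- \<alpha>) *\<^sub>R f r) else 0) has_integral B *\<^sub>R integral {0..t} f) UNIV"
    by (rule has_integral_spike_finite[OF _ _ H, of "{0, t}"]) (use H_in H_out in auto)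
  then show ?thesis by (simp only: has_integral_restrict_UNIV B_def)
qed

section \<open>Power series in a fractional power of time\<close>

text \<open>
  With \<open>c l = g (A\<^sup>l)\<close> for a linear functional \<open>g\<close> this is \<open>g (E\<^sub>\<alpha>(A t\<^sup>\<alpha>))\<close>.  The powers are written
  \<open>(t powr \<alpha>) ^ l\<close> and not \<open>t powr (\<alpha> * l)\<close>, because the latter is 0 instead of 1 for \<open>t = 0\<close>
  and \<open>l = 0\<close>.
\<close>

definition fractional_series :: "real \<Rightarrow> (nat \<Rightarrow> real) \<Rightarrow> real \<Rightarrow> real" where
  "fractional_series \<alpha> c t = (\<Sum>l. c l / Gamma (\<alpha> * real l + 1) * (t powr \<alpha>) ^ l)"

text \<open>
  The termwise derivative by the chain rule through \<open>z = t powr \<alpha>\<close>.  Keeping the factor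
  \<open>t powr (\<alpha> - 1)\<close> outside isolates the only singularity.
\<close>

definition fractional_series_deriv :: "real \<Rightarrow> (nat \<Rightarrow> real) \<Rightarrow> real \<Rightarrow> real" where
  "fractional_series_deriv \<alpha> c t =
     \<alpha> * t powr (\<alpha> - 1) * (\<Sum>l. diffs (\<lambda>l. c l / Gamma (\<alpha> * real l + 1)) l * (t powr \<alpha>) ^ l)"

context
  fixes \<alpha> M K :: real and c :: "nat \<Rightarrow> real"
  assumes \<alpha>: "0 < \<alpha>" and c: "\<And>l. \<bar>c l\<bar> \<le> M * K ^ l" and K: "0 \<le> K"
begin

lemma power_series_field_derivative:
  "((\<lambda>z. \<Sum>l. c l / Gamma (\<alpha> * real l + 1) * z ^ l) has_field_derivative
     (\<Sum>l. diffs (\<lambda>l. c l / Gamma (\<alpha> * real l + 1)) l * z ^ l)) (at z)"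
  by (rule termdiffs_strong_converges_everywhere[OF summable_mittag_leffler_coeffs[OF \<alpha> c K]])

lemma continuous_on_powr_const: "continuous_on {0..} (\<lambda>t. t powr \<alpha>)"
  by (intro continuous_on_powr' continuous_intros) (use \<alpha> in auto)

lemma fractional_series_continuous: "continuous_on {0..T} (fractional_series \<alpha> c)"
proof -
  have "continuous_on UNIV (\<lambda>z. \<Sum>l. c l / Gamma (\<alpha> * real l + 1) * z ^ l)"
    by (intro continuous_at_imp_continuous_on ballI DERIV_isCont[OF power_series_field_derivative])
  then show ?thesis
    unfolding fractional_series_def
    by (rule continuous_on_compose2) (auto intro: continuous_on_subset[OF continuous_on_powr_const])
qed

lemma fractional_series_has_real_derivative:
  assumes "0 < t"
  shows "(fractional_series \<alpha> c has_real_derivative fractional_series_deriv \<alpha> c t) (at t within S)"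
proof -
  have "((\<lambda>t. t powr \<alpha>) has_real_derivative \<alpha> * t powr (\<alpha> - 1)) (at t within S)"
    using has_real_derivative_powr[OF assms, of \<alpha>] by (rule has_field_derivative_at_within)
  from DERIV_chain2[OF power_series_field_derivative this]
  show ?thesis by (simp add: fractional_series_def[abs_def] fractional_series_deriv_def mult.commute)
qed

lemma derived_series_continuous:
  "continuous_on UNIV (\<lambda>z. \<Sum>l. diffs (\<lambda>l. c l / Gamma (\<alpha> * real l + 1)) l * z ^ l)"
  by (intro continuous_at_imp_continuous_on ballI DERIV_isCont[OF termdiffs_strong_converges_everywhere]
      termdiff_converges_all summable_mittag_leffler_coeffs[OF \<alpha> c K])

lemma fractional_series_deriv_continuous:
  "continuous_on {0<..T} (fractional_series_deriv \<alpha> c)"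
  unfolding fractional_series_deriv_def
  by (intro continuous_intros continuous_on_compose2[OF derived_series_continuous]) auto

text \<open>
  The singular factor \<open>t powr (\<alpha> - 1)\<close> is integrable and the remaining factor is continuous up to 0.
\<close>

lemma fractional_series_deriv_absolutely_integrable:
  assumes "0 \<le> T"
  shows "fractional_series_deriv \<alpha> c absolutely_integrable_on {0..T}"
proof -
  have cont: "continuous_on {0..T} (\<lambda>t. \<Sum>l. diffs (\<lambda>l. c l / Gamma (\<alpha> * real l + 1)) l * (t powr \<alpha>) ^ l)"
    by (rule continuous_on_compose2[OF derived_series_continuous])
      (auto intro: continuous_on_subset[OF continuous_on_powr_const])
  have pow: "(\<lambda>t. t powr (\<alpha> - 1)) absolutely_integrable_on {0..T}"
    using has_integral_powr_from_0[of "\<alpha> - 1" T] \<alpha> assms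
    by (intro nonnegative_absolutely_integrable_1) auto
  have "(\<lambda>t. (\<Sum>l. diffs (\<lambda>l. c l / Gamma (\<alpha> * real l + 1)) l * (t powr \<alpha>) ^ l) * t powr (\<alpha> - 1))
      absolutely_integrable_on {0..T}"
    by (intro absolutely_integrable_bounded_measurable_product_real pow
        continuous_imp_measurable_on_sets_lebesgue compact_imp_bounded compact_continuous_image cont) auto
  from absolutely_integrable_scaleR_left[OF this, of \<alpha>]
  show ?thesis by (simp add: fractional_series_deriv_def[abs_def] mult_ac)
qed

text \<open>
  The scalar form of the equation.  Since
  \<open>\<alpha> (l + 1) / \<Gamma> (\<alpha> (l + 1) + 1) = 1 / \<Gamma> (\<alpha> (l + 1))\<close>, the Beta integral turns the derivative of the
  term with index \<open>l + 1\<close> into \<open>\<Gamma> (1 - \<alpha>)\<close> times the term with index \<open>l\<close> and coefficient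
  \<open>c (l + 1)\<close>.  Sum and integral are interchanged by dominated convergence, with
  \<open>(t - s)\<^sup>-\<^sup>\<alpha> s\<^sup>\<alpha>\<^sup>-\<^sup>1\<close> times a constant as majorant.
\<close>

lemma fractional_series_abel:
  assumes \<alpha>1: "\<alpha> < 1" and t: "0 < t"
  shows "integral {0..t} (\<lambda>s. (t - s) powr (- \<alpha>) * fractional_series_deriv \<alpha> c s)
           = Gamma (1 - \<alpha>) * fractional_series \<alpha> (\<lambda>l. c (Suc l)) t"
proof -
  define d where "d = diffs (\<lambda>l. c l / Gamma (\<alpha> * real l + 1))"
  have d_sum: "summable (\<lambda>l. d l * z ^ l)" for z
    unfolding d_def by (rule termdiff_converges_all[OF summable_mittag_leffler_coeffs[OF \<alpha> c K]])
  have d_norm: "summable (\<lambda>l. \<bar>d l\<bar> * (t powr \<alpha>) ^ l)"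
    using powser_insidea[OF d_sum[of "t powr \<alpha> + 1"], of "t powr \<alpha>"] by (simp add: abs_mult)
  have \<alpha>d: "\<alpha> * d l = c (Suc l) / Gamma (\<alpha> * (real l + 1))" for l
  proof -
    define x where "x = \<alpha> * (real l + 1)"
    have "x > 0" using \<alpha> by (simp add: x_def add_nonneg_pos)
    then have "x \<notin> \<int>\<^sub>\<le>\<^sub>0" using nonpos_Ints_nonpos by force
    then have "Gamma (x + 1) = x * Gamma x" by (rule Gamma_plus1)
    moreover have "\<alpha> * d l = x * c (Suc l) / Gamma (x + 1)"
      by (simp add: d_def diffs_def x_def add.commute)
    ultimately show ?thesis using \<open>x > 0\<close> unfolding x_def[symmetric] by simp
  qed
  define f where "f = (\<lambda>N s. \<Sum>l<N. (t - s) powr (- \<alpha>) * (\<alpha> * s powr (\<alpha> - 1)) * (d l * (s powr \<alpha>) ^ l))"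
  have term_int: "((\<lambda>s. (t - s) powr (- \<alpha>) * (\<alpha> * s powr (\<alpha> - 1)) * (d l * (s powr \<alpha>) ^ l))
      has_integral Gamma (1 - \<alpha>) * (c (Suc l) / Gamma (\<alpha> * real l + 1) * (t powr \<alpha>) ^ l)) {0..t}" for l
  proof -
    let ?a = "\<alpha> * (real l + 1)"
    have a: "?a > 0" using \<alpha> by (simp add: add_nonneg_pos)
    have "((\<lambda>s. (\<alpha> * d l) * ((s - 0) powr (?a - 1) * (t - s) powr ((1 - \<alpha>) - 1))) has_integral
       (\<alpha> * d l) * ((t - 0) powr (?a + (1 - \<alpha>) - 1) * Beta ?a (1 - \<alpha>))) {0..t}"
      using has_integral_Beta_interval[OF a, of "1 - \<alpha>" 0 t] \<alpha>1 t by (intro has_integral_mult_right) simp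
    moreover have "(\<alpha> * d l) * ((t - 0) powr (?a + (1 - \<alpha>) - 1) * Beta ?a (1 - \<alpha>))
       = Gamma (1 - \<alpha>) * (c (Suc l) / Gamma (\<alpha> * real l + 1) * (t powr \<alpha>) ^ l)"
    proof -
      have e1: "?a + (1 - \<alpha>) - 1 = \<alpha> * real l" and e2: "?a + (1 - \<alpha>) = \<alpha> * real l + 1"
        by (simp_all add: algebra_simps)
      have e3: "t powr (\<alpha> * real l) = (t powr \<alpha>) ^ l"
        using t by (simp add: powr_powr[symmetric] powr_realpow)
      show ?thesis
        unfolding \<alpha>d Beta_def e1 e2 diff_0_right e3 using Gamma_real_pos[OF a] e3 by simp
    qed
    ultimately show ?thesis
    proof (rule has_integral_eq[rotated, OF back_subst[of "\<lambda>i. (_ has_integral i) _"]])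
      fix s assume s: "s \<in> {0..t}"
      show "(\<alpha> * d l) * ((s - 0) powr (?a - 1) * (t - s) powr ((1 - \<alpha>) - 1)) =
          (t - s) powr (- \<alpha>) * (\<alpha> * s powr (\<alpha> - 1)) * (d l * (s powr \<alpha>) ^ l)"
      proof (cases "s = 0")
        case False
        then have "(s powr \<alpha>) ^ l = s powr (\<alpha> * real l)"
          using s by (simp add: powr_powr[symmetric] powr_realpow)
        moreover have "s powr (?a - 1) = s powr (\<alpha> - 1) * s powr (\<alpha> * real l)"
          by (simp add: powr_add[symmetric] algebra_simps)
        ultimately show ?thesis by simp
      qed simp
    qed
  qed
  have f_int: "(f N has_integral Gamma (1 - \<alpha>) * (\<Sum>l<N. c (Suc l) / Gamma (\<alpha> * real l + 1) * (t powr \<alpha>) ^ l)) {0..t}" for N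
    unfolding f_def sum_distrib_left by (intro has_integral_sum term_int) simp
  define G where "G = (\<Sum>l. \<bar>d l\<bar> * (t powr \<alpha>) ^ l)"
  have "(\<lambda>s. ((s - 0) powr (\<alpha> - 1) * (t - s) powr ((1 - \<alpha>) - 1)) * (\<alpha> * G)) integrable_on {0..t}"
    using has_integral_Beta_interval[of \<alpha> "1 - \<alpha>" 0 t] \<alpha> \<alpha>1 t
    by (intro integrable_on_mult_left) auto
  then have h_int: "(\<lambda>s. (t - s) powr (- \<alpha>) * (\<alpha> * s powr (\<alpha> - 1)) * G) integrable_on {0..t}"
    by (simp add: mult_ac)
  have le: "norm (f N s) \<le> (t - s) powr (- \<alpha>) * (\<alpha> * s powr (\<alpha> - 1)) * G" if s: "s \<in> {0..t}" for N s
  proof -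
    have "\<bar>\<Sum>l<N. d l * (s powr \<alpha>) ^ l\<bar> \<le> (\<Sum>l<N. \<bar>d l * (s powr \<alpha>) ^ l\<bar>)" by (rule sum_abs)
    also have "\<dots> \<le> (\<Sum>l<N. \<bar>d l\<bar> * (t powr \<alpha>) ^ l)"
      using s \<alpha> by (intro sum_mono) (auto simp: abs_mult intro!: mult_left_mono power_mono powr_mono2)
    also have "\<dots> \<le> G" unfolding G_def by (rule sum_le_suminf[OF d_norm]) auto
    finally show ?thesis
      unfolding f_def sum_distrib_left[symmetric] using \<alpha>
      by (auto simp: abs_mult intro!: mult_left_mono)
  qed
  have conv: "(\<lambda>N. f N s) \<longlonglongrightarrow> (t - s) powr (- \<alpha>) * fractional_series_deriv \<alpha> c s" for s
    unfolding f_def sum_distrib_left[symmetric] fractional_series_deriv_def d_def[symmetric] mult.assoc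
    by (intro tendsto_mult_left summable_LIMSEQ d_sum)
  have "(\<lambda>N. integral {0..t} (f N)) \<longlonglongrightarrow> integral {0..t} (\<lambda>s. (t - s) powr (- \<alpha>) * fractional_series_deriv \<alpha> c s)"
    by (rule dominated_convergence(2)[OF _ h_int le conv]) (use f_int in blast)
  then have 1: "(\<lambda>N. Gamma (1 - \<alpha>) * (\<Sum>l<N. c (Suc l) / Gamma (\<alpha> * real l + 1) * (t powr \<alpha>) ^ l))
      \<longlonglongrightarrow> integral {0..t} (\<lambda>s. (t - s) powr (- \<alpha>) * fractional_series_deriv \<alpha> c s)"
    by (simp only: integral_unique[OF f_int])
  have "\<bar>c (Suc l)\<bar> \<le> (M * K) * K ^ l" for l using c[of "Suc l"] by (simp add: mult_ac)
  then have "summable (\<lambda>l. c (Suc l) / Gamma (\<alpha> * real l + 1) * (t powr \<alpha>) ^ l)"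
    by (rule summable_mittag_leffler_coeffs[OF \<alpha> _ K])
  then have 2: "(\<lambda>N. Gamma (1 - \<alpha>) * (\<Sum>l<N. c (Suc l) / Gamma (\<alpha> * real l + 1) * (t powr \<alpha>) ^ l))
      \<longlonglongrightarrow> Gamma (1 - \<alpha>) * fractional_series \<alpha> (\<lambda>l. c (Suc l)) t"
    unfolding fractional_series_def by (intro tendsto_mult_left summable_LIMSEQ)
  show ?thesis by (rule LIMSEQ_unique[OF 1 2])
qed

end

section \<open>Orbits of the Mittag-Leffler matrix function\<close>

lemma linear_matrix_mult_left: "linear (\<lambda>P :: real^'n^'m. A ** P)" for A :: "real^'m^'k"
  by (rule linearI) (simp_all add: matrix_add_ldistrib matrix_scalar_ac scalar_matrix_assoc)

lemma bounded_linear_matrix_vector_right: "bounded_linear (\<lambda>X :: real^'n^'m. X *v a)"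
  unfolding linear_conv_bounded_linear[symmetric]
  by (rule linearI) (simp_all add: matrix_vector_mult_add_rdistrib scaleR_matrix_vector_assoc)

lemma norm_matrix_power_le:
  fixes A :: "real^'n^'n"
  obtains M K where "0 \<le> K" and "\<And>l. norm (matrix_power A l) \<le> M * K ^ l"
proof -
  obtain K where K: "0 \<le> K" "\<And>P :: real^'n^'n. norm (A ** P) \<le> norm P * K"
    using bounded_linear.nonneg_bounded[of "\<lambda>P. A ** P"] linear_matrix_mult_left[of A]
    unfolding linear_conv_bounded_linear by blast
  have "norm (matrix_power A l) \<le> norm (mat 1 :: real^'n^'n) * K ^ l" for l
  proof (induction l)
    case (Suc l)
    have "norm (matrix_power A (Suc l)) \<le> norm (matrix_power A l) * K" by (simp add: K)
    also have "\<dots> \<le> (norm (mat 1 :: real^'n^'n) * K ^ l) * K"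
      by (rule mult_right_mono[OF Suc K(1)])
    finally show ?case by (simp add: mult_ac)
  qed simp
  with K(1) that show thesis by blast
qed

lemma matrix_power_scaleR: "matrix_power (c *\<^sub>R A) l = c ^ l *\<^sub>R matrix_power A l"
  by (induction l) (simp_all add: matrix_scalar_ac scalar_matrix_assoc[symmetric] mult.commute)

lemma functional_matrix_power_le:
  fixes A :: "real^'n^'n" and g :: "real^'n^'n \<Rightarrow> real"
  assumes "bounded_linear g"
  obtains M K where "0 \<le> K" and "\<And>l. \<bar>g (matrix_power A l)\<bar> \<le> M * K ^ l"
proof -
  obtain M K where K: "0 \<le> K" "\<And>l. norm (matrix_power A l) \<le> M * K ^ l"
    by (rule norm_matrix_power_le[of A]) blast
  obtain G where G: "0 \<le> G" "\<And>X. norm (g X) \<le> norm X * G"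
    using bounded_linear.nonneg_bounded[OF assms] by blast
  have "\<bar>g (matrix_power A l)\<bar> \<le> (M * G) * K ^ l" for l
    using order_trans[OF G(2) mult_right_mono[OF K(2) G(1)], of l] by (simp add: mult_ac)
  with K(1) that show thesis by blast
qed

text \<open>
  Applying a linear functional reduces the matrix series to scalar series; it is used with
  \<open>X \<mapsto> (X a)\<^sub>i\<close> and with \<open>X \<mapsto> (A X a)\<^sub>i\<close>.
\<close>

lemma functional_mittag_leffler:
  fixes A :: "real^'n^'n" and g :: "real^'n^'n \<Rightarrow> real"
  assumes "0 < \<alpha>" and g: "bounded_linear g"
  shows "g (mittag_leffler \<alpha> ((t powr \<alpha>) *\<^sub>R A)) = fractional_series \<alpha> (\<lambda>l. g (matrix_power A l)) t"
proof -
  obtain M K where K: "0 \<le> K" "\<And>l. norm (matrix_power A l) \<le> M * K ^ l"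
    by (rule norm_matrix_power_le[of A]) blast
  have "summable (\<lambda>l. norm (matrix_power A l) / Gamma (\<alpha> * real l + 1) * (t powr \<alpha>) ^ l)"
    by (rule summable_mittag_leffler_coeffs[where M = M and K = K]) (use assms K in auto)
  then have "summable (\<lambda>l. (1 / Gamma (\<alpha> * real l + 1)) *\<^sub>R matrix_power ((t powr \<alpha>) *\<^sub>R A) l)"
    using assms(1) by (intro summable_norm_cancel[of "\<lambda>l. (1 / Gamma (\<alpha> * real l + 1)) *\<^sub>R _ l"])
      (simp add: matrix_power_scaleR add_nonneg_pos abs_mult mult_ac)
  from bounded_linear.suminf[OF g this] show ?thesis
    by (simp add: mittag_leffler_def fractional_series_def matrix_power_scaleR
        linear_cmul[OF bounded_linear.linear[OF g]] mult_ac)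
qed

lemma bounded_linear_matrix_vector_component: "bounded_linear (\<lambda>X :: real^'n^'m. (X *v a) $ i)"
  by (rule bounded_linear_compose[OF bounded_linear_vec_nth bounded_linear_matrix_vector_right])

definition mittag_leffler_orbit_deriv ::
    "real \<Rightarrow> real^'n^'n \<Rightarrow> real^'n \<Rightarrow> real \<Rightarrow> real^'n" where
  "mittag_leffler_orbit_deriv \<alpha> A a t =
     (\<chi> i. fractional_series_deriv \<alpha> (\<lambda>l. (matrix_power A l *v a) $ i) t)"

context
  fixes \<alpha> :: real and A :: "real^'n^'n" and a :: "real^'n"
  assumes \<alpha>: "0 < \<alpha>"
begin

lemma orbit_component:
  "(mittag_leffler \<alpha> ((t powr \<alpha>) *\<^sub>R A) *v a) $ i = fractional_series \<alpha> (\<lambda>l. (matrix_power A l *v a) $ i) t"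
  by (rule functional_mittag_leffler[OF \<alpha> bounded_linear_matrix_vector_component])

lemma orbit_coeff_bound:
  obtains M K where "0 \<le> K" and "\<And>l. \<bar>(matrix_power A l *v a) $ i\<bar> \<le> M * K ^ l"
  by (rule functional_matrix_power_le[OF bounded_linear_matrix_vector_component[of a i], where A = A]) (rule that)

lemma orbit_continuous:
  "continuous_on {0..T} (\<lambda>t. mittag_leffler \<alpha> ((t powr \<alpha>) *\<^sub>R A) *v a)"
proof -
  have "continuous_on {0..T} (\<lambda>t. (mittag_leffler \<alpha> ((t powr \<alpha>) *\<^sub>R A) *v a) $ i)" for i
    unfolding orbit_component by (rule orbit_coeff_bound) (rule fractional_series_continuous[OF \<alpha>])
  then have "continuous_on {0..T} (\<lambda>t. \<chi> i. (mittag_leffler \<alpha> ((t powr \<alpha>) *\<^sub>R A) *v a) $ i)"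
    by (rule continuous_on_vec_lambda)
  then show ?thesis by simp
qed

lemma orbit_has_vector_derivative:
  assumes "0 < t"
  shows "((\<lambda>t. mittag_leffler \<alpha> ((t powr \<alpha>) *\<^sub>R A) *v a) has_vector_derivative
           mittag_leffler_orbit_deriv \<alpha> A a t) (at t within S)"
proof -
  have "((\<lambda>t. (mittag_leffler \<alpha> ((t powr \<alpha>) *\<^sub>R A) *v a) $ i) has_real_derivative
      mittag_leffler_orbit_deriv \<alpha> A a t $ i) (at t within S)" for i
    unfolding orbit_component mittag_leffler_orbit_deriv_def vec_lambda_beta
    by (rule orbit_coeff_bound) (rule fractional_series_has_real_derivative[OF \<alpha> _ _ assms])
  then show ?thesis
    unfolding has_vector_derivative_def has_derivative_componentwise_within[of "\<lambda>t. _ t *v a"]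
    by (auto simp: Basis_vec_def inner_axis has_field_derivative_def mult_commute_abs)
qed

lemma orbit_deriv_continuous: "continuous_on {0<..T} (mittag_leffler_orbit_deriv \<alpha> A a)"
proof -
  have "continuous_on {0<..T} (fractional_series_deriv \<alpha> (\<lambda>l. (matrix_power A l *v a) $ i))" for i
    by (rule orbit_coeff_bound) (rule fractional_series_deriv_continuous[OF \<alpha>])
  then show ?thesis
    unfolding mittag_leffler_orbit_deriv_def[abs_def] by (rule continuous_on_vec_lambda)
qed

lemma orbit_deriv_absolutely_integrable:
  assumes "0 \<le> T"
  shows "mittag_leffler_orbit_deriv \<alpha> A a absolutely_integrable_on {0..T}"
proof -
  have "(\<lambda>t. mittag_leffler_orbit_deriv \<alpha> A a t $ i) absolutely_integrable_on {0..T}" for i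
    unfolding mittag_leffler_orbit_deriv_def vec_lambda_beta
    by (rule orbit_coeff_bound) (rule fractional_series_deriv_absolutely_integrable[OF \<alpha> _ _ assms])
  then have comp: "(\<lambda>t. mittag_leffler_orbit_deriv \<alpha> A a t \<bullet> axis i 1) absolutely_integrable_on {0..T}" for i
    by (simp add: inner_axis)
  show ?thesis
  proof (rule absolutely_integrable_componentwise)
    fix b :: "real^'n" assume "b \<in> Basis"
    then obtain i where b: "b = axis i 1" by (auto simp: Basis_vec_def)
    show "(\<lambda>t. mittag_leffler_orbit_deriv \<alpha> A a t \<bullet> b) absolutely_integrable_on {0..T}"
      unfolding b by (rule comp)
  qed
qed

lemma orbit_initial_value: "mittag_leffler \<alpha> ((0 powr \<alpha>) *\<^sub>R A) *v a = a"
proof -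
  have "fractional_series \<alpha> c 0 = c 0" for c
    unfolding fractional_series_def using powser_sums_zero[of "\<lambda>l. c l / Gamma (\<alpha> * real l + 1)"]
    by (simp add: sums_unique[symmetric])
  then show ?thesis unfolding vec_eq_iff orbit_component by simp
qed

text \<open>
  The orbit solves the untempered equation: shifting the coefficients \<open>A\<^sup>l a\<close> by one place
  multiplies them by \<open>A\<close>.
\<close>

lemma orbit_abel:
  assumes \<alpha>1: "\<alpha> < 1" and t: "0 < t"
  shows "integral {0..t} (\<lambda>s. (t - s) powr (- \<alpha>) *\<^sub>R mittag_leffler_orbit_deriv \<alpha> A a s)
           = Gamma (1 - \<alpha>) *\<^sub>R (A *v (mittag_leffler \<alpha> ((t powr \<alpha>) *\<^sub>R A) *v a))"
proof -
  have "(\<lambda>s. (t - s) powr (1 - \<alpha> - 1) *\<^sub>R mittag_leffler_orbit_deriv \<alpha> A a s) absolutely_integrable_on {0..t}"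
    using \<alpha>1 t by (intro abel_absolutely_integrable[where T = t, OF _ orbit_deriv_absolutely_integrable orbit_deriv_continuous]) auto
  then have int: "(\<lambda>s. (t - s) powr (- \<alpha>) *\<^sub>R mittag_leffler_orbit_deriv \<alpha> A a s) integrable_on {0..t}"
    by (simp add: set_lebesgue_integral_eq_integral(1))
  show ?thesis unfolding vec_eq_iff
  proof
    fix i
    have "bounded_linear (\<lambda>X :: real^'n^'n. (A *v (X *v a)) $ i)"
      by (intro bounded_linear_compose[OF bounded_linear_vec_nth]
          bounded_linear_compose[OF matrix_vector_mul_bounded_linear bounded_linear_matrix_vector_right])
    note shift = functional_mittag_leffler[OF \<alpha> this]
    have "integral {0..t} (\<lambda>s. (t - s) powr (- \<alpha>) *\<^sub>R mittag_leffler_orbit_deriv \<alpha> A a s) $ i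
      = integral {0..t} (\<lambda>s. (t - s) powr (- \<alpha>) * fractional_series_deriv \<alpha> (\<lambda>l. (matrix_power A l *v a) $ i) s)"
      unfolding integral_component_eq_cart[OF int, symmetric] by (simp add: mittag_leffler_orbit_deriv_def)
    also have "\<dots> = Gamma (1 - \<alpha>) * fractional_series \<alpha> (\<lambda>l. (matrix_power A (Suc l) *v a) $ i) t"
      by (rule orbit_coeff_bound) (rule fractional_series_abel[OF \<alpha> _ _ \<alpha>1 t])
    also have "\<dots> = (Gamma (1 - \<alpha>) *\<^sub>R (A *v (mittag_leffler \<alpha> ((t powr \<alpha>) *\<^sub>R A) *v a))) $ i"
      by (simp add: shift matrix_vector_mul_assoc[symmetric])
    finally show "integral {0..t} (\<lambda>s. (t - s) powr (- \<alpha>) *\<^sub>R mittag_leffler_orbit_deriv \<alpha> A a s) $ i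
       = (Gamma (1 - \<alpha>) *\<^sub>R (A *v (mittag_leffler \<alpha> ((t powr \<alpha>) *\<^sub>R A) *v a))) $ i" .
  qed
qed

end

section \<open>The tempered equation and its solution class\<close>

text \<open>
  The product rule removes the tempering: \<open>\<rho> v + v' = exp (- \<rho> s) x'\<close> for \<open>v = exp (- \<rho> s) x\<close>, and the
  two exponentials multiply to \<open>exp (- \<rho> t)\<close>, which does not depend on \<open>s\<close>.
\<close>

lemma caputo_tempered_exp:
  fixes x :: "real \<Rightarrow> real^'n"
  assumes t: "0 < t" "t \<le> T"
    and x: "\<And>s. s \<in> {0<..T} \<Longrightarrow> (x has_vector_derivative x' s) (at s within {0..T})"
  shows "caputo_tempered \<alpha> \<rho> (\<lambda>s. exp (- \<rho> * s) *\<^sub>R x s) t =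
           (exp (- \<rho> * t) / Gamma (1 - \<alpha>)) *\<^sub>R integral {0..t} (\<lambda>s. (t - s) powr (- \<alpha>) *\<^sub>R x' s)"
proof -
  let ?v = "\<lambda>s. exp (- \<rho> * s) *\<^sub>R x s"
  have "integral {0..t} (\<lambda>s. (exp (- \<rho> * (t - s)) * (t - s) powr (- \<alpha>)) *\<^sub>R
          (\<rho> *\<^sub>R ?v s + vector_derivative ?v (at s within {0..t})))
      = integral {0..t} (\<lambda>s. exp (- \<rho> * t) *\<^sub>R ((t - s) powr (- \<alpha>) *\<^sub>R x' s))"
  proof (rule integral_spike[of "{0}"])
    fix s assume "s \<in> {0..t} - {0}"
    then have s: "0 < s" "s \<le> t" by auto
    have "(x has_vector_derivative x' s) (at s within {0..t})"
      using x[of s] s t by (rule_tac has_vector_derivative_within_subset) auto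
    then have "(?v has_vector_derivative exp (- \<rho> * s) *\<^sub>R x' s + (- \<rho> * exp (- \<rho> * s)) *\<^sub>R x s) (at s within {0..t})"
      by (intro has_vector_derivative_scaleR) (auto intro!: derivative_eq_intros)
    then have "vector_derivative ?v (at s within {0..t}) = exp (- \<rho> * s) *\<^sub>R x' s + (- \<rho> * exp (- \<rho> * s)) *\<^sub>R x s"
      using s t by (intro vector_derivative_within_closed_interval) auto
    moreover have "exp (- \<rho> * (t - s)) * exp (- \<rho> * s) = exp (- \<rho> * t)"
      by (simp add: exp_add[symmetric] algebra_simps)
    ultimately show "exp (- \<rho> * t) *\<^sub>R ((t - s) powr (- \<alpha>) *\<^sub>R x' s) =
        (exp (- \<rho> * (t - s)) * (t - s) powr (- \<alpha>)) *\<^sub>R (\<rho> *\<^sub>R ?v s + vector_derivative ?v (at s within {0..t}))"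
      by (simp add: mult_ac)
  qed simp
  note this[unfolded integral_cmul]
  then show ?thesis unfolding caputo_tempered_def by simp
qed

lemma solution_classI:
  assumes "continuous_on {0..T} v"
    and "\<And>t. t \<in> {0<..T} \<Longrightarrow> (v has_vector_derivative v' t) (at t within {0..T})"
    and "continuous_on {0<..T} v'" and "v' absolutely_integrable_on {0..T}"
  shows "solution_class T v"
  unfolding solution_class_def using assms by (intro conjI exI[of _ v']) auto

lemma solution_class_exp:
  fixes v :: "real \<Rightarrow> real^'n"
  assumes "solution_class T v"
  shows "solution_class T (\<lambda>t. exp (k * t) *\<^sub>R v t)"
proof -
  obtain v' where v: "continuous_on {0..T} v" "continuous_on {0<..T} v'" "v' absolutely_integrable_on {0..T}"
    and d: "\<And>t. t \<in> {0<..T} \<Longrightarrow> (v has_vector_derivative v' t) (at t within {0..T})"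
    using assms unfolding solution_class_def by blast
  let ?w = "\<lambda>t. exp (k * t) *\<^sub>R v' t + (k * exp (k * t)) *\<^sub>R v t"
  have "((\<lambda>t. exp (k * t) *\<^sub>R v t) has_vector_derivative ?w t) (at t within {0..T})" if "t \<in> {0<..T}" for t
    using d[OF that] by (intro has_vector_derivative_scaleR) (auto intro!: derivative_eq_intros)
  moreover have "continuous_on {0<..T} ?w"
    by (intro continuous_intros v(2) continuous_on_subset[OF v(1)]) auto
  moreover have "?w absolutely_integrable_on {0..T}"
  proof (rule set_integral_add(1))
    show "(\<lambda>t. exp (k * t) *\<^sub>R v' t) absolutely_integrable_on {0..T}"
      by (rule absolutely_integrable_bounded_measurable_product[OF
          bilinear_conv_bounded_bilinear[THEN iffD2, OF bounded_bilinear_scaleR] _ _ _ v(3)])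
        (auto intro!: continuous_imp_measurable_on_sets_lebesgue
          compact_imp_bounded compact_continuous_image continuous_intros)
    show "(\<lambda>t. (k * exp (k * t)) *\<^sub>R v t) absolutely_integrable_on {0..T}"
      by (intro absolutely_integrable_continuous_real continuous_intros v(1))
  qed
  moreover have "continuous_on {0..T} (\<lambda>t. exp (k * t) *\<^sub>R v t)"
    by (intro continuous_intros v(1))
  ultimately show ?thesis by (intro solution_classI) auto
qed

text \<open>
  The form in which a member of the solution class is used: its rescaled derivative represents the
  Caputo derivative at all times at once.
\<close>

lemma solution_class_caputo:
  fixes v :: "real \<Rightarrow> real^'n"
  assumes "solution_class T v"
  obtains x' where "x' absolutely_integrable_on {0..T}" and "continuous_on {0<..T} x'"
    and "\<And>s. s \<in> {0<..T} \<Longrightarrow> ((\<lambda>s. exp (\<rho> * s) *\<^sub>R v s) has_vector_derivative x' s) (at s within {0..T})"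
    and "\<And>t. t \<in> {0<..T} \<Longrightarrow> caputo_tempered \<alpha> \<rho> v t =
           (exp (- \<rho> * t) / Gamma (1 - \<alpha>)) *\<^sub>R integral {0..t} (\<lambda>s. (t - s) powr (- \<alpha>) *\<^sub>R x' s)"
proof -
  obtain x' where x': "x' absolutely_integrable_on {0..T}" "continuous_on {0<..T} x'"
    and d: "\<And>s. s \<in> {0<..T} \<Longrightarrow> ((\<lambda>s. exp (\<rho> * s) *\<^sub>R v s) has_vector_derivative x' s) (at s within {0..T})"
    using solution_class_exp[OF assms, of \<rho>] unfolding solution_class_def by blast
  have v: "v = (\<lambda>s. exp (- \<rho> * s) *\<^sub>R (exp (\<rho> * s) *\<^sub>R v s))" by (simp add: exp_add[symmetric])
  have "caputo_tempered \<alpha> \<rho> v t =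
      (exp (- \<rho> * t) / Gamma (1 - \<alpha>)) *\<^sub>R integral {0..t} (\<lambda>s. (t - s) powr (- \<alpha>) *\<^sub>R x' s)"
    if "t \<in> {0<..T}" for t
    using that by (subst v) (rule caputo_tempered_exp[OF _ _ d], auto)
  with x' d that show thesis by blast
qed

lemma solution_class_diff:
  assumes "solution_class T v" and "solution_class T w"
  shows "solution_class T (\<lambda>t. v t - w t)"
proof -
  obtain v' where v: "continuous_on {0..T} v" "continuous_on {0<..T} v'" "v' absolutely_integrable_on {0..T}"
    and dv: "\<And>t. t \<in> {0<..T} \<Longrightarrow> (v has_vector_derivative v' t) (at t within {0..T})"
    using assms(1) unfolding solution_class_def by blast
  obtain w' where w: "continuous_on {0..T} w" "continuous_on {0<..T} w'" "w' absolutely_integrable_on {0..T}"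
    and dw: "\<And>t. t \<in> {0<..T} \<Longrightarrow> (w has_vector_derivative w' t) (at t within {0..T})"
    using assms(2) unfolding solution_class_def by blast
  have "((\<lambda>t. v t - w t) has_vector_derivative v' t - w' t) (at t within {0..T})" if "t \<in> {0<..T}" for t
    using dv dw that by (intro has_vector_derivative_diff)
  moreover have "continuous_on {0<..T} (\<lambda>t. v' t - w' t)" by (intro continuous_intros v w)
  moreover have "(\<lambda>t. v' t - w' t) absolutely_integrable_on {0..T}" by (rule set_integral_diff(1)[OF v(3) w(3)])
  moreover have "continuous_on {0..T} (\<lambda>t. v t - w t)" by (intro continuous_intros v w)
  ultimately show ?thesis by (intro solution_classI) auto
qed

lemma solution_class_restrict:
  assumes "solution_class T v" and "tf \<le> T"
  shows "solution_class tf v"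
proof -
  obtain v' where v: "continuous_on {0..T} v" "continuous_on {0<..T} v'" "v' absolutely_integrable_on {0..T}"
    and dv: "\<And>t. t \<in> {0<..T} \<Longrightarrow> (v has_vector_derivative v' t) (at t within {0..T})"
    using assms(1) unfolding solution_class_def by blast
  have "(v has_vector_derivative v' t) (at t within {0..tf})" if "t \<in> {0<..tf}" for t
    using that assms(2) by (intro has_vector_derivative_within_subset[OF dv]) auto
  moreover have "continuous_on {0<..tf} v'" "continuous_on {0..tf} v"
    using assms(2) by (auto intro!: continuous_on_subset[OF v(1)] continuous_on_subset[OF v(2)])
  moreover have "v' absolutely_integrable_on {0..tf}"
    using assms(2) by (intro absolutely_integrable_on_subinterval[OF v(3)]) auto
  ultimately show ?thesis by (intro solution_classI) auto
qed

lemma caputo_tempered_diff: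
  fixes v w :: "real \<Rightarrow> real^'n"
  assumes "\<alpha> < 1" and "solution_class T v" and "solution_class T w" and t: "t \<in> {0<..T}"
  shows "caputo_tempered \<alpha> \<rho> (\<lambda>s. v s - w s) t = caputo_tempered \<alpha> \<rho> v t - caputo_tempered \<alpha> \<rho> w t"
proof -
  obtain x' where x: "x' absolutely_integrable_on {0..T}" "continuous_on {0<..T} x'"
    "\<And>s. s \<in> {0<..T} \<Longrightarrow> ((\<lambda>s. exp (\<rho> * s) *\<^sub>R v s) has_vector_derivative x' s) (at s within {0..T})"
    "\<And>t. t \<in> {0<..T} \<Longrightarrow> caputo_tempered \<alpha> \<rho> v t =
           (exp (- \<rho> * t) / Gamma (1 - \<alpha>)) *\<^sub>R integral {0..t} (\<lambda>s. (t - s) powr (- \<alpha>) *\<^sub>R x' s)"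
    by (rule solution_class_caputo[OF assms(2)]) blast
  obtain z' where z: "z' absolutely_integrable_on {0..T}" "continuous_on {0<..T} z'"
    "\<And>s. s \<in> {0<..T} \<Longrightarrow> ((\<lambda>s. exp (\<rho> * s) *\<^sub>R w s) has_vector_derivative z' s) (at s within {0..T})"
    "\<And>t. t \<in> {0<..T} \<Longrightarrow> caputo_tempered \<alpha> \<rho> w t =
           (exp (- \<rho> * t) / Gamma (1 - \<alpha>)) *\<^sub>R integral {0..t} (\<lambda>s. (t - s) powr (- \<alpha>) *\<^sub>R z' s)"
    by (rule solution_class_caputo[OF assms(3)]) blast
  have int: "(\<lambda>s. (t - s) powr (- \<alpha>) *\<^sub>R f s) integrable_on {0..t}"
    if "f absolutely_integrable_on {0..T}" "continuous_on {0<..T} f" for f :: "real \<Rightarrow> real^'n"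
    using abel_absolutely_integrable[OF _ that, of "1 - \<alpha>" t] t assms(1)
    by (simp add: set_lebesgue_integral_eq_integral(1))
  have vw: "(\<lambda>s. v s - w s) = (\<lambda>s. exp (- \<rho> * s) *\<^sub>R (exp (\<rho> * s) *\<^sub>R v s - exp (\<rho> * s) *\<^sub>R w s))"
    by (simp add: exp_add[symmetric] scaleR_diff_right[symmetric])
  have "caputo_tempered \<alpha> \<rho> (\<lambda>s. v s - w s) t = (exp (- \<rho> * t) / Gamma (1 - \<alpha>)) *\<^sub>R
      integral {0..t} (\<lambda>s. (t - s) powr (- \<alpha>) *\<^sub>R (x' s - z' s))"
    unfolding vw using t
    by (intro caputo_tempered_exp[where T = T] has_vector_derivative_diff x(3) z(3)) auto
  also have "integral {0..t} (\<lambda>s. (t - s) powr (- \<alpha>) *\<^sub>R (x' s - z' s)) =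
      integral {0..t} (\<lambda>s. (t - s) powr (- \<alpha>) *\<^sub>R x' s) - integral {0..t} (\<lambda>s. (t - s) powr (- \<alpha>) *\<^sub>R z' s)"
    unfolding scaleR_diff_right by (rule integral_diff[OF int[OF x(1,2)] int[OF z(1,2)]])
  finally show ?thesis by (simp add: x(4)[OF t] z(4)[OF t] scaleR_diff_right)
qed

lemma is_solution_diff:
  assumes "\<alpha> < 1" and "is_solution \<alpha> \<rho> T A B u a y" and "is_solution \<alpha> \<rho> T A B w b z"
  shows "is_solution \<alpha> \<rho> T A B (\<lambda>t. u t - w t) (a - b) (\<lambda>t. y t - z t)"
  using assms unfolding is_solution_def
  by (auto simp: solution_class_diff caputo_tempered_diff[of \<alpha> T] matrix_vector_mult_diff_distrib)

text \<open>
  The Caputo derivative at \<open>t\<close> only looks at \<open>[0, t]\<close>, so knowledge of the input on \<open>[0, tf]\<close> is enough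
  there.
\<close>

lemma is_solution_restrict:
  assumes "is_solution \<alpha> \<rho> T A B u a y" and "tf \<le> T" and "\<And>t. t \<in> {0..tf} \<Longrightarrow> u t = w t"
  shows "is_solution \<alpha> \<rho> tf A B w a y"
  using assms unfolding is_solution_def by (auto simp: solution_class_restrict)

lemma mittag_leffler_is_solution:
  fixes A :: "real^'n^'n" and B :: "real^'m^'n"
  assumes \<alpha>: "0 < \<alpha>" "\<alpha> < 1" and T: "0 < T"
  shows "is_solution \<alpha> \<rho> T A B (\<lambda>t. 0) a (\<lambda>t. exp (- \<rho> * t) *\<^sub>R (mittag_leffler \<alpha> ((t powr \<alpha>) *\<^sub>R A) *v a))"
proof -
  let ?x = "\<lambda>t. mittag_leffler \<alpha> ((t powr \<alpha>) *\<^sub>R A) *v a"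
  have "solution_class T ?x"
    by (rule solution_classI[OF orbit_continuous orbit_has_vector_derivative orbit_deriv_continuous
          orbit_deriv_absolutely_integrable]) (use \<alpha> T in auto)
  then have "solution_class T (\<lambda>t. exp (- \<rho> * t) *\<^sub>R ?x t)" by (rule solution_class_exp)
  moreover have "caputo_tempered \<alpha> \<rho> (\<lambda>t. exp (- \<rho> * t) *\<^sub>R ?x t) t = A *v (exp (- \<rho> * t) *\<^sub>R ?x t)"
    if "t \<in> {0<..T}" for t
  proof -
    have "Gamma (1 - \<alpha>) \<noteq> 0" using Gamma_real_pos[of "1 - \<alpha>"] \<alpha> by linarith
    have "caputo_tempered \<alpha> \<rho> (\<lambda>t. exp (- \<rho> * t) *\<^sub>R ?x t) t = (exp (- \<rho> * t) / Gamma (1 - \<alpha>)) *\<^sub>R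
        integral {0..t} (\<lambda>s. (t - s) powr (- \<alpha>) *\<^sub>R mittag_leffler_orbit_deriv \<alpha> A a s)"
      using that \<alpha> by (intro caputo_tempered_exp[where T = T] orbit_has_vector_derivative) auto
    then show ?thesis
      using that \<alpha> \<open>Gamma (1 - \<alpha>) \<noteq> 0\<close> by (simp add: orbit_abel matrix_vector_mult_scaleR)
  qed
  ultimately show ?thesis
    unfolding is_solution_def using orbit_initial_value[OF \<alpha>(1), of A a] by simp
qed

section \<open>Uniqueness of solutions\<close>

text \<open>
  Starting from a bound for \<open>x\<close>, each use of the integral equation gains a factor \<open>K\<close> and one fractional
  integration; after \<open>N\<close> uses the bound is the \<open>N\<close>-th term of a convergent Mittag-Leffler series,
  hence tends to 0.
\<close>

lemma volterra_unique:
  fixes x :: "real \<Rightarrow> real^'n"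
  assumes \<alpha>: "0 < \<alpha>" and cont: "continuous_on {0..T} x"
    and eq: "\<And>t. t \<in> {0<..T} \<Longrightarrow>
       ((\<lambda>s. (t - s) powr (\<alpha> - 1) *\<^sub>R (A *v x s)) has_integral Gamma \<alpha> *\<^sub>R x t) {0..t}"
    and zero: "x 0 = 0" and t: "t \<in> {0..T}"
  shows "x t = 0"
proof -
  obtain K where K: "0 \<le> K" "\<And>v. norm (A *v v) \<le> norm v * K"
    using bounded_linear.nonneg_bounded[OF matrix_vector_mul_bounded_linear[of A]] by blast
  have "compact (x ` {0..T})" by (intro compact_continuous_image cont) auto
  then have "bounded (x ` {0..T})" by (rule compact_imp_bounded)
  then obtain M where M: "\<And>t. t \<in> {0..T} \<Longrightarrow> norm (x t) \<le> M"
    unfolding bounded_iff by (meson imageI)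
  have bound: "norm (x t) \<le> M * K ^ N / Gamma (\<alpha> * real N + 1) * (t powr \<alpha>) ^ N"
    if "t \<in> {0<..T}" for N t
    using that
  proof (induction N arbitrary: t)
    case 0
    then show ?case using M[of t] by simp
  next
    case (Suc N)
    define b where "b = \<alpha> * real N + 1"
    have b: "b > 0" using \<alpha> by (simp add: b_def add_nonneg_pos)
    have G: "Gamma \<alpha> > 0" "Gamma b > 0" using \<alpha> b by simp_all
    have t: "0 < t" "t \<le> T" using Suc.prems by auto
    have pow: "(s powr \<alpha>) ^ N = s powr (b - 1)" if "0 < s" for s
      using that by (simp add: b_def powr_powr[symmetric] powr_realpow)
    define C where "C = M * K ^ Suc N / Gamma b"
    have majorant: "((\<lambda>s. ((s - 0) powr (b - 1) * (t - s) powr (\<alpha> - 1)) * C) has_integral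
        ((t - 0) powr (b + \<alpha> - 1) * Beta b \<alpha>) * C) {0..t}"
      using b \<alpha> t by (intro has_integral_mult_left has_integral_Beta_interval) auto
    have "norm (Gamma \<alpha> *\<^sub>R x t) \<le> ((t - 0) powr (b + \<alpha> - 1) * Beta b \<alpha>) * C"
    proof (rule has_integral_norm_bound_integral_component[
          OF eq[OF Suc.prems] majorant, where k = 1, simplified real_inner_1_right])
      fix s assume s: "s \<in> {0..t}"
      show "norm ((t - s) powr (\<alpha> - 1) *\<^sub>R (A *v x s)) \<le> ((s - 0) powr (b - 1) * (t - s) powr (\<alpha> - 1)) * C"
      proof (cases "s = 0")
        case False
        have "norm (A *v x s) \<le> (M * K ^ N / Gamma b * (s powr \<alpha>) ^ N) * K"
          using s t False Suc.IH[of s] K by (intro order_trans[OF K(2)] mult_right_mono) (auto simp: b_def)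
        also have "\<dots> = s powr (b - 1) * C" using pow[of s] s False by (simp add: C_def)
        finally have "(t - s) powr (\<alpha> - 1) * norm (A *v x s) \<le> (t - s) powr (\<alpha> - 1) * (s powr (b - 1) * C)"
          by (rule mult_left_mono) simp
        then show ?thesis by (simp add: mult_ac)
      qed (simp add: zero)
    qed
    then have "norm (x t) \<le> t powr (b + \<alpha> - 1) * Beta b \<alpha> * C / Gamma \<alpha>"
      using G by (simp add: field_simps)
    also have "\<dots> = M * K ^ Suc N / Gamma (b + \<alpha>) * t powr (b + \<alpha> - 1)"
      using G by (simp add: Beta_def C_def)
    also have "b + \<alpha> = \<alpha> * real (Suc N) + 1" by (simp add: b_def algebra_simps)
    also have "t powr (\<alpha> * real (Suc N) + 1 - 1) = (t powr \<alpha>) ^ Suc N"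
      using t powr_realpow[of "t powr \<alpha>" "Suc N"] by (simp only: powr_powr) simp
    finally show ?case .
  qed
  show ?thesis
  proof (cases "t = 0")
    case False
    have M0: "0 \<le> M" using order_trans[OF norm_ge_zero M[OF t]] .
    have "summable (\<lambda>N. (M * K ^ N) / Gamma (\<alpha> * real N + 1) * (t powr \<alpha>) ^ N)"
      by (rule summable_mittag_leffler_coeffs[where M = M and K = K]) (use \<alpha> K M0 in auto)
    then have "(\<lambda>N. (M * K ^ N) / Gamma (\<alpha> * real N + 1) * (t powr \<alpha>) ^ N) \<longlonglongrightarrow> 0"
      by (rule summable_LIMSEQ_zero)
    then have "norm (x t) \<le> 0"
      by (rule LIMSEQ_le_const) (use bound[of t] t False in auto)
    then show ?thesis by simp
  qed (simp add: zero)
qed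

text \<open>
  Applying \<open>I\<^sup>\<alpha>\<close> to the rescaled equation \<open>I\<^sup>1\<^sup>-\<^sup>\<alpha> x' = A x\<close> gives \<open>x = I\<^sup>\<alpha> (A x)\<close>, by
  Abel inversion on the left and the fundamental theorem of calculus.
\<close>

lemma homogeneous_solution_zero:
  fixes A :: "real^'n^'n"
  assumes \<alpha>: "0 < \<alpha>" "\<alpha> < 1" and y: "is_solution \<alpha> \<rho> T A B (\<lambda>t. 0) 0 y" and t: "t \<in> {0..T}"
  shows "y t = 0"
proof -
  let ?x = "\<lambda>s. exp (\<rho> * s) *\<^sub>R y s"
  have sol: "solution_class T y" and y0: "y 0 = 0"
    and eq: "\<And>t. t \<in> {0<..T} \<Longrightarrow> caputo_tempered \<alpha> \<rho> y t = A *v y t"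
    using y by (auto simp: is_solution_def)
  have cont: "continuous_on {0..T} ?x"
    using solution_class_exp[OF sol] by (simp add: solution_class_def)
  obtain x' where x': "x' absolutely_integrable_on {0..T}" "continuous_on {0<..T} x'"
    and d: "\<And>s. s \<in> {0<..T} \<Longrightarrow> (?x has_vector_derivative x' s) (at s within {0..T})"
    and cap: "\<And>t. t \<in> {0<..T} \<Longrightarrow> caputo_tempered \<alpha> \<rho> y t =
           (exp (- \<rho> * t) / Gamma (1 - \<alpha>)) *\<^sub>R integral {0..t} (\<lambda>s. (t - s) powr (- \<alpha>) *\<^sub>R x' s)"
    by (rule solution_class_caputo[OF sol]) blast
  have G: "Gamma (1 - \<alpha>) > 0" using \<alpha> by simp
  have J: "integral {0..s} (\<lambda>r. (s - r) powr (- \<alpha>) *\<^sub>R x' r) = Gamma (1 - \<alpha>) *\<^sub>R (A *v ?x s)"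
    if s: "s \<in> {0<..T}" for s
  proof -
    let ?J = "integral {0..s} (\<lambda>r. (s - r) powr (- \<alpha>) *\<^sub>R x' r)"
    have "(Gamma (1 - \<alpha>) * exp (\<rho> * s)) *\<^sub>R (A *v y s) =
        (Gamma (1 - \<alpha>) * exp (\<rho> * s)) *\<^sub>R ((exp (- \<rho> * s) / Gamma (1 - \<alpha>)) *\<^sub>R ?J)"
      using cap[OF s] eq[OF s] by simp
    also have "\<dots> = ?J" using G by (simp add: exp_minus)
    finally show ?thesis by (simp add: matrix_vector_mult_scaleR)
  qed
  have "?x t = 0"
  proof (rule volterra_unique[OF \<alpha>(1) cont _ _ t])
    fix t assume t: "t \<in> {0<..T}"
    have "(x' has_integral ?x t - ?x 0) {0..t}"
    proof (rule fundamental_theorem_of_calculus_interior)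
      show "continuous_on {0..t} ?x" using t by (intro continuous_on_subset[OF cont]) auto
      fix s assume s: "s \<in> {0<..<t}"
      then have "s \<in> {0<..T}" using t by auto
      from d[OF this] have "(?x has_vector_derivative x' s) (at s within {0<..<t})"
        by (rule has_vector_derivative_within_subset) (use t in auto)
      then show "(?x has_vector_derivative x' s) (at s)"
        using s by (simp add: at_within_open[of s "{0<..<t}"])
    qed (use t in auto)
    then have "integral {0..t} x' = ?x t" using y0 by (simp add: integral_unique)
    then have "((\<lambda>s. (t - s) powr (\<alpha> - 1) *\<^sub>R integral {0..s} (\<lambda>r. (s - r) powr (- \<alpha>) *\<^sub>R x' r))
        has_integral (Gamma \<alpha> * Gamma (1 - \<alpha>)) *\<^sub>R ?x t) {0..t}"
      using abel_inversion[OF \<alpha> x', of t] t by simp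
    then have "((\<lambda>s. Gamma (1 - \<alpha>) *\<^sub>R ((t - s) powr (\<alpha> - 1) *\<^sub>R (A *v ?x s)))
        has_integral (Gamma \<alpha> * Gamma (1 - \<alpha>)) *\<^sub>R ?x t) {0..t}"
      by (rule has_integral_spike_finite[of "{0}", rotated 2]) (use t J in auto)
    from has_integral_cmul[OF this, of "inverse (Gamma (1 - \<alpha>))"]
    have "((\<lambda>s. (inverse (Gamma (1 - \<alpha>)) * Gamma (1 - \<alpha>)) *\<^sub>R ((t - s) powr (\<alpha> - 1) *\<^sub>R (A *v ?x s)))
        has_integral (inverse (Gamma (1 - \<alpha>)) * Gamma (1 - \<alpha>) * Gamma \<alpha>) *\<^sub>R ?x t) {0..t}"
      by (simp only: scaleR_scaleR mult_ac)
    moreover have "inverse (Gamma (1 - \<alpha>)) * Gamma (1 - \<alpha>) = 1" using G by simp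
    ultimately
    show "((\<lambda>s. (t - s) powr (\<alpha> - 1) *\<^sub>R (A *v ?x s)) has_integral Gamma \<alpha> *\<^sub>R ?x t) {0..t}"
      by (simp only: mult_1_left scaleR_one)
  qed (simp add: y0)
  then show ?thesis by simp
qed

lemma free_solution_unique:
  fixes A :: "real^'n^'n"
  assumes \<alpha>: "0 < \<alpha>" "\<alpha> < 1" and y: "is_solution \<alpha> \<rho> T A B (\<lambda>t. 0) a y" and t: "t \<in> {0..T}" "0 < T"
  shows "y t = exp (- \<rho> * t) *\<^sub>R (mittag_leffler \<alpha> ((t powr \<alpha>) *\<^sub>R A) *v a)"
proof -
  have "is_solution \<alpha> \<rho> T A B (\<lambda>t. 0 - 0) (a - a)
      (\<lambda>t. y t - exp (- \<rho> * t) *\<^sub>R (mittag_leffler \<alpha> ((t powr \<alpha>) *\<^sub>R A) *v a))"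
    by (rule is_solution_diff[OF \<alpha>(2) y mittag_leffler_is_solution[OF \<alpha> t(2)]])
  from homogeneous_solution_zero[OF \<alpha> this[simplified] t(1)] show ?thesis by simp
qed

section \<open>The observability Gramian\<close>

lemma mittag_leffler_continuous:
  fixes A :: "real^'n^'n"
  assumes "0 < \<alpha>"
  shows "continuous_on {0..T} (\<lambda>t. mittag_leffler \<alpha> ((t powr \<alpha>) *\<^sub>R A))"
proof -
  have "continuous_on {0..T} (\<lambda>t. \<chi> i j. (mittag_leffler \<alpha> ((t powr \<alpha>) *\<^sub>R A) *v axis j 1) $ i)"
    by (intro continuous_on_vec_lambda continuous_on_component orbit_continuous assms)
  then show ?thesis by (simp add: matrix_vector_mult_basis column_def)
qed

definition free_output :: "real \<Rightarrow> real \<Rightarrow> real^'n^'n \<Rightarrow> real^'n^'p \<Rightarrow> real^'n \<Rightarrow> real \<Rightarrow> real^'p" where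
  "free_output \<alpha> \<rho> A C a t = C *v (exp (- \<rho> * t) *\<^sub>R (mittag_leffler \<alpha> ((t powr \<alpha>) *\<^sub>R A) *v a))"

lemma observability_gramian_mult:
  fixes A :: "real^'n^'n" and C :: "real^'n^'p"
  assumes "0 < \<alpha>"
  shows "((\<lambda>t. transpose (exp (- \<rho> * t) *\<^sub>R mittag_leffler \<alpha> ((t powr \<alpha>) *\<^sub>R A)) *v
            (transpose C *v free_output \<alpha> \<rho> A C a t))
          has_integral observability_gramian \<alpha> \<rho> A C tf *v a) {0..tf}"
proof -
  let ?F = "\<lambda>t. (exp (- \<rho> * t) *\<^sub>R transpose (mittag_leffler \<alpha> ((t powr \<alpha>) *\<^sub>R A))) ** transpose C ** C
       ** (exp (- \<rho> * t) *\<^sub>R mittag_leffler \<alpha> ((t powr \<alpha>) *\<^sub>R A))"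
  have "continuous_on {0..tf} ?F"
    unfolding matrix_matrix_mult_def transpose_def
    by (intro continuous_intros continuous_on_vec_lambda continuous_on_component mittag_leffler_continuous assms)
  then have "(?F has_integral observability_gramian \<alpha> \<rho> A C tf) {0..tf}"
    unfolding observability_gramian_def by (intro integrable_integral integrable_continuous_real)
  from has_integral_linear[OF this bounded_linear_matrix_vector_right[of a]]
  show ?thesis
    by (simp add: o_def free_output_def matrix_vector_mul_assoc scaleR_matrix_vector_assoc
       matrix_mul_assoc transpose_scalar)
qed

text \<open>
  The quadratic form \<open>a \<bullet> W a\<close> is the integral of the squared norm of the free output, a continuous
  nonnegative function, so it vanishes only if the free output does.
\<close>

lemma gramian_kernel:
  fixes A :: "real^'n^'n" and C :: "real^'n^'p"
  assumes "0 < \<alpha>" and "0 < tf"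
  shows "observability_gramian \<alpha> \<rho> A C tf *v a = 0 \<longleftrightarrow> (\<forall>t\<in>{0..tf}. free_output \<alpha> \<rho> A C a t = 0)"
proof
  note W = observability_gramian_mult[OF assms(1), of \<rho> A C a tf]
  assume "\<forall>t\<in>{0..tf}. free_output \<alpha> \<rho> A C a t = 0"
  then have "((\<lambda>t. 0) has_integral observability_gramian \<alpha> \<rho> A C tf *v a) {0..tf}"
    by (intro has_integral_eq[OF _ W]) simp
  then show "observability_gramian \<alpha> \<rho> A C tf *v a = 0"
    using has_integral_unique has_integral_0 by blast
next
  note W = observability_gramian_mult[OF assms(1), of \<rho> A C a tf]
  assume zero: "observability_gramian \<alpha> \<rho> A C tf *v a = 0"
  have quad: "a \<bullet> (transpose (exp (- \<rho> * t) *\<^sub>R mittag_leffler \<alpha> ((t powr \<alpha>) *\<^sub>R A)) *v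
            (transpose C *v free_output \<alpha> \<rho> A C a t)) = (norm (free_output \<alpha> \<rho> A C a t))\<^sup>2" for t
    by (simp add: power2_norm_eq_inner transpose_matrix_vector inner_commute[of a] dot_lmul_matrix
        free_output_def scaleR_matrix_vector_assoc)
  have "((\<lambda>t. (norm (free_output \<alpha> \<rho> A C a t))\<^sup>2) has_integral 0) {0..tf}"
    using has_integral_linear[OF W bounded_linear_inner_right[of a]]
    by (simp only: o_def quad zero inner_zero_right)
  moreover have "continuous_on {0..tf} (\<lambda>t. (norm (free_output \<alpha> \<rho> A C a t))\<^sup>2)"
    unfolding free_output_def
    by (rule continuous_on_power, rule continuous_on_norm,
        rule bounded_linear.continuous_on[OF matrix_vector_mul_bounded_linear],
        rule continuous_on_scaleR[OF _ orbit_continuous[OF assms(1)]]) (intro continuous_intros)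
  ultimately show "\<forall>t\<in>{0..tf}. free_output \<alpha> \<rho> A C a t = 0"
    using integral_eq_0_iff[of 0 tf "\<lambda>t. (norm (free_output \<alpha> \<rho> A C a t))\<^sup>2"] assms(2)
    by (simp add: integral_unique)
qed

theorem theorem3p4:
  fixes \<alpha> \<rho> T tf :: real
    and A :: "real^'n^'n" and B :: "real^'m^'n" and C :: "real^'n^'p" and D :: "real^'m^'p"
  assumes "0 < \<rho>" and "0 < \<alpha>" and "\<alpha> < 1" and "0 < T" and "0 < tf" and "tf \<le> T"
  shows "observable \<alpha> \<rho> T A B C D tf \<longleftrightarrow>
         invertible (observability_gramian \<alpha> \<rho> A C tf)"
proof -
  let ?W = "observability_gramian \<alpha> \<rho> A C tf"
  have "observable \<alpha> \<rho> T A B C D tf \<longleftrightarrow> (\<forall>a. ?W *v a = 0 \<longrightarrow> a = 0)"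
  proof
    assume obs: "observable \<alpha> \<rho> T A B C D tf"
    show "\<forall>a. ?W *v a = 0 \<longrightarrow> a = 0"
    proof (intro allI impI)
      fix a assume "?W *v a = 0"
      then have out: "\<forall>t\<in>{0..tf}. free_output \<alpha> \<rho> A C a t = 0"
        using gramian_kernel[OF assms(2,5)] by blast
      \<comment> \<open>the states \<open>a\<close> and \<open>0\<close> with zero input produce the same zero output\<close>
      let ?y = "\<lambda>a t. exp (- \<rho> * t) *\<^sub>R (mittag_leffler \<alpha> ((t powr \<alpha>) *\<^sub>R A) *v a)"
      have "is_solution \<alpha> \<rho> T A B (\<lambda>t. 0) a (?y a)" "is_solution \<alpha> \<rho> T A B (\<lambda>t. 0) 0 (?y 0)"
        by (rule mittag_leffler_is_solution[OF assms(2,3,4)])+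
      moreover have "system_output C D (\<lambda>t. 0) (?y a) t = system_output C D (\<lambda>t. 0) (?y 0) t" if "t \<in> {0..tf}" for t
        using out that by (simp add: system_output_def free_output_def)
      ultimately show "a = 0" using obs unfolding observable_def by blast
    qed
  next
    assume ker: "\<forall>a. ?W *v a = 0 \<longrightarrow> a = 0"
    show "observable \<alpha> \<rho> T A B C D tf"
      unfolding observable_def
    proof (intro allI impI, elim conjE)
      fix u\<^sub>1 u\<^sub>2 y\<^sub>1 y\<^sub>2 a\<^sub>1 a\<^sub>2
      assume 1: "is_solution \<alpha> \<rho> T A B u\<^sub>1 a\<^sub>1 y\<^sub>1" and 2: "is_solution \<alpha> \<rho> T A B u\<^sub>2 a\<^sub>2 y\<^sub>2"
        and u: "\<forall>t\<in>{0..tf}. u\<^sub>1 t = u\<^sub>2 t"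
        and z: "\<forall>t\<in>{0..tf}. system_output C D u\<^sub>1 y\<^sub>1 t = system_output C D u\<^sub>2 y\<^sub>2 t"
      have sol: "is_solution \<alpha> \<rho> tf A B (\<lambda>t. 0) (a\<^sub>1 - a\<^sub>2) (\<lambda>t. y\<^sub>1 t - y\<^sub>2 t)"
        by (rule is_solution_restrict[OF is_solution_diff[OF assms(3) 1 2] assms(6)]) (use u in auto)
      have "free_output \<alpha> \<rho> A C (a\<^sub>1 - a\<^sub>2) t = 0" if t: "t \<in> {0..tf}" for t
      proof -
        have "C *v (y\<^sub>1 t - y\<^sub>2 t) = 0"
          using u z t by (simp add: system_output_def matrix_vector_mult_diff_distrib)
        then show ?thesis
          using free_solution_unique[OF assms(2,3) sol t assms(5)] by (simp add: free_output_def)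
      qed
      then have "?W *v (a\<^sub>1 - a\<^sub>2) = 0" using gramian_kernel[OF assms(2,5)] by blast
      with ker show "a\<^sub>1 = a\<^sub>2" by (metis eq_iff_diff_eq_0)
    qed
  qed
  also have "\<dots> \<longleftrightarrow> invertible ?W"
    by (simp add: invertible_left_inverse matrix_left_invertible_ker)
  finally show ?thesis .
qed

end
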